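(* Let $\Bbbk$ be a field of characteristic zero. Suppose $\mathbf f=c\prod_{i=1}^m(x+\xi_i)\prod_{j=1}^n(y+\chi_j)$ where $c\in\Bbbk^\times$ and $(\xi_i)_{i=1}^m$, $(\chi_j)_{j=1}^n$ are families of distinct scalars in $\Bbbk$. If $m,n\ge3$, then $\mathbf f$ is $1$-flabby, namely ${}^1\Gamma_0(K\{\mathbf f\})=\Bbbk[x,y]$. As a consequence, $\mathrm{vht}_1(K\{\mathbf f\})=\mathrm{fht}(K\{\mathbf f\})=\deg\mathbf f$, and $K\{\mathbf f\}$ is height cohereditary.
   Context: For $\mathbf f\in\Bbbk(x,y)$, $K\{\mathbf f\}$ denotes the rational function field $\Bbbk(x,y)$ equipped with the unique ($\Bbbk$-bilinear) Poisson bracket such that $\{x,y\}=\mathbf f$; explicitly $\{g,h\}=\left(\frac{\partial g}{\partial x}\frac{\partial h}{\partial y}-\frac{\partial g}{\partial y}\frac{\partial h}{\partial x}\right)\mathbf f$. Let $K$ be a Poisson field over $\Bbbk$ and $w\in\mathbb Z$. A $w$-valuation on $K$ is a map $\nu:K\to\mathbb Z\cup\{\infty\}$ such that for all $a,b\in K$: $\nu(a)=\infty$ iff $a=0$; $\nu(ab)=\nu(a)+\nu(b)$; $\nu(a+b)\ge\min(\nu(a),\nu(b))$; $\nu(a)=0$ for $a\in\Bbbk^\times$; and $\nu(\{a,b\})\ge\nu(a)+\nu(b)-w$. It is trivial if $\nu(a)=0$ for all $a\neq0$, and classical if $\nu(\{a,b\})>\nu(a)+\nu(b)-w$ for all nonzero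 $a,b$. Put $F_0^\nu(K)=\{a\in K\mid\nu(a)\ge0\}$, and for $n\in\mathbb Z$ let ${}^n\Gamma_0(K)=\{a\in K\mid\nu(a)\ge0\text{ for all nontrivial }n\text{-valuations }\nu\text{ on }K\}$ (which is $K$ if there are none). A polynomial $\mathbf g\in\Bbbk[x,y]$ is $d$-flabby ($d\ge 1$) if ${}^d\Gamma_0(K\{\mathbf g\})=\Bbbk[x,y]$. If the bracket on $K$ is nontrivial, the $n$-valuation height is $\mathrm{vht}_n(K)=2+\inf\{w\in\mathbb Z\mid \text{there is a non-classical }w\text{-valuation }\nu\text{ on }K\text{ with }F_0^\nu(K)\cap{}^n\Gamma_0(K)=\Bbbk\}$ (with $\inf\emptyset=+\infty$, and $-\infty$ allowed). For $K$ of the form $K\{\mathbf f\}$, the flag height $\mathrm{fht}(K)$ is the minimum of the total degrees $\deg\mathbf g$ over $\mathbf g\in\Bbbk[x,y]$ with $K\cong K\{\mathbf g\}$ as Poisson fields, and $\infty$ if no such $\mathbf g$ exists. Such a $K$ is height cohereditary if $\mathrm{fht}(K)\le\mathrm{fht}(K')$ for every Poisson field $K'$ of the form $K\{\mathbf g\}$, $\mathbf g\in\Bbbk(x,y)$, into which $K$ embeds as a Poisson subfield. *)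

theory Defs
  imports
    "HOL-Computational_Algebra.Polynomial_Factorial"
    "HOL-Library.Extended"
    "HOL-Library.Extended_Real"
begin

section \<open>The field of rational functions in two variables\<close>

text \<open>The polynomial ring k[x,y] is (k[x])[y]: the inner variable is x, the outer one is y.
  So the coefficient of x^i y^j in p is \<^term>\<open>coeff (coeff p j) i\<close>.\<close>

type_synonym 'k poly2 = "'k poly poly"
type_synonym 'k rat2 = "'k poly poly fract"

definition const2 :: "'k::field \<Rightarrow> 'k poly2" where
  "const2 c = [:[:c:]:]"

definition X2 :: "'k::field poly2" where
  "X2 = [:[:0, 1:]:]"

definition Y2 :: "'k::field poly2" where
  "Y2 = [:0, 1:]"

text \<open>The zero polynomial gets total degree 0, as for the library's \<^const>\<open>degree\<close>.\<close>

definition total_degree :: "'k::field poly2 \<Rightarrow> nat" where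
  "total_degree p = Max (insert 0 {i + j | i j. coeff (coeff p j) i \<noteq> 0})"

lemma finite_monomials: "finite {i + j | i j. coeff (coeff (p :: 'k::field poly2) j) i \<noteq> 0}"
proof -
  have "{(i, j). coeff (coeff p j) i \<noteq> 0} \<subseteq> (\<Union>j\<in>{..degree p}. (\<lambda>i. (i, j)) ` {..degree (coeff p j)})"
  proof (clarsimp simp: image_iff)
    fix i j assume *: "coeff (coeff p j) i \<noteq> 0"
    from * have "coeff p j \<noteq> 0" by auto
    with * show "j \<le> degree p \<and> i \<le> degree (coeff p j)"
      by (auto intro: le_degree)
  qed
  hence "finite {(i, j). coeff (coeff p j) i \<noteq> 0}"
    by (rule finite_subset) auto
  moreover have "{i + j | i j. coeff (coeff p j) i \<noteq> 0} =
      (\<lambda>(i, j). i + j) ` {(i, j). coeff (coeff p j) i \<noteq> 0}" by auto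
  ultimately show ?thesis by simp
qed


subsection \<open>Partial derivatives\<close>

locale derivation =
  fixes d :: "'a::comm_ring_1 \<Rightarrow> 'a"
  assumes add: "d (a + b) = d a + d b"
    and mult: "d (a * b) = d a * b + a * d b"
begin

lemma zero: "d 0 = 0"
  using add[of 0 0] by simp

lemma one: "d 1 = 0"
  using mult[of 1 1] by simp

lemma minus: "d (- a) = - d a"
  using add[of a "- a"] by (simp add: zero eq_neg_iff_add_eq_0 add.commute)

lemma diff: "d (a - b) = d a - d b"
  using add[of a "- b"] by (simp add: minus)

lemma quotient_rule_respects:
  assumes "a * b' = a' * b"
  shows "(d a * b - a * d b) * (b' * b') = (d a' * b' - a' * d b') * (b * b)"
proof -
  have "d a * b' + a * d b' = d a' * b + a' * d b"
    using arg_cong[OF assms, of d] by (simp add: mult)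
  hence *: "d a * b' = d a' * b + a' * d b - a * d b'"
    by (simp add: algebra_simps)
  have "(d a * b - a * d b) * (b' * b') = (d a * b') * (b * b') - (a * b') * (d b * b')"
    by (simp add: algebra_simps)
  also have "\<dots> = (d a' * b) * (b * b') + (a' * b) * (d b * b')
      - (a * b') * (b * d b') - (a * b') * (d b * b')"
    unfolding * by (simp add: algebra_simps)
  also have "\<dots> = (d a' * b' - a' * d b') * (b * b)"
    unfolding assms by (simp add: algebra_simps)
  finally show ?thesis .
qed

end

lemma derivation_pderiv: "derivation (pderiv :: 'a::idom poly \<Rightarrow> 'a poly)"
  by standard (simp_all add: pderiv_add pderiv_mult algebra_simps)

lemma derivation_map_poly:
  assumes "derivation (d :: 'a::idom \<Rightarrow> 'a)"
  shows "derivation (map_poly d)"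
proof -
  interpret derivation d by fact
  have sum: "d (sum f A) = (\<Sum>x\<in>A. d (f x))" for f :: "nat \<Rightarrow> 'a" and A
    by (induction A rule: infinite_finite_induct) (simp_all add: zero add)
  show ?thesis
  proof
    fix p q :: "'a poly"
    show "map_poly d (p + q) = map_poly d p + map_poly d q"
      by (rule poly_eqI) (simp add: coeff_map_poly zero add)
    show "map_poly d (p * q) = map_poly d p * q + p * map_poly d q"
      by (rule poly_eqI) (simp add: coeff_map_poly zero coeff_mult sum mult sum.distrib)
  qed
qed

text \<open>The extension of a derivation to the fraction field by the quotient rule. The value does not
  depend on the representation of the fraction.\<close>

definition fract_derivation :: "('a::idom \<Rightarrow> 'a) \<Rightarrow> 'a fract \<Rightarrow> 'a fract" where
  "fract_derivation d q =
     (THE r. \<exists>a b. b \<noteq> 0 \<and> q = Fract a b \<and> r = Fract (d a * b - a * d b) (b * b))"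

lemma fract_derivation_Fract:
  fixes d :: "'a::idom \<Rightarrow> 'a"
  assumes "derivation d" "b \<noteq> 0"
  shows "fract_derivation d (Fract a b) = Fract (d a * b - a * d b) (b * b)"
  unfolding fract_derivation_def
proof (rule the_equality)
  show "\<exists>a' b'. b' \<noteq> 0 \<and> Fract a b = Fract a' b' \<and>
      Fract (d a * b - a * d b) (b * b) = Fract (d a' * b' - a' * d b') (b' * b')"
    using assms(2) by blast
next
  fix r
  assume "\<exists>a' b'. b' \<noteq> 0 \<and> Fract a b = Fract a' b' \<and>
      r = Fract (d a' * b' - a' * d b') (b' * b')"
  then obtain a' b' where *: "b' \<noteq> 0" "Fract a b = Fract a' b'"
      "r = Fract (d a' * b' - a' * d b') (b' * b')" by blast
  with assms(2) have "a * b' = a' * b" by (simp add: eq_fract)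
  from derivation.quotient_rule_respects[OF assms(1) this]
  show "r = Fract (d a * b - a * d b) (b * b)"
    using * assms(2) by (simp add: eq_fract)
qed

definition pdx :: "'k::field rat2 \<Rightarrow> 'k rat2" where
  "pdx = fract_derivation (map_poly pderiv)"

definition pdy :: "'k::field rat2 \<Rightarrow> 'k rat2" where
  "pdy = fract_derivation pderiv"

lemma pdx_Fract: "b \<noteq> 0 \<Longrightarrow>
    pdx (Fract a b) = Fract (map_poly pderiv a * b - a * map_poly pderiv b) (b * b)"
  unfolding pdx_def
  by (rule fract_derivation_Fract[OF derivation_map_poly[OF derivation_pderiv]])

lemma pdy_Fract: "b \<noteq> 0 \<Longrightarrow> pdy (Fract a b) = Fract (pderiv a * b - a * pderiv b) (b * b)"
  unfolding pdy_def by (rule fract_derivation_Fract[OF derivation_pderiv])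

lemma derivation_fract:
  fixes d :: "'a::idom \<Rightarrow> 'a"
  assumes "derivation d"
    and D: "\<And>a b. b \<noteq> 0 \<Longrightarrow> D (Fract a b) = Fract (d a * b - a * d b) (b * b)"
  shows "derivation D"
proof -
  interpret derivation d by fact
  show ?thesis
  proof
    fix p q :: "'a fract"
    obtain a b where p: "p = Fract a b" "b \<noteq> 0" by (cases p)
    obtain a' b' where q: "q = Fract a' b'" "b' \<noteq> 0" by (cases q)
    show "D (p + q) = D p + D q"
      using p q by (simp add: D eq_fract add mult algebra_simps)
    show "D (p * q) = D p * q + p * D q"
      using p q by (simp add: D eq_fract mult algebra_simps)
  qed
qed

interpretation pdx: derivation pdx
  by (rule derivation_fract[OF derivation_map_poly[OF derivation_pderiv] pdx_Fract])

interpretation pdy: derivation pdy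
  by (rule derivation_fract[OF derivation_pderiv pdy_Fract])

lemma pdx_to_fract: "pdx (to_fract p) = to_fract (map_poly pderiv p)"
  by (simp add: to_fract_def pdx_Fract derivation.one[OF derivation_map_poly[OF derivation_pderiv]])

lemma pdy_to_fract: "pdy (to_fract p) = to_fract (pderiv p)"
  by (simp add: to_fract_def pdy_Fract)

lemma pdx_pdy_commute: "pdx (pdy q) = pdy (pdx q)"
proof -
  define E where "E = (\<lambda>q :: 'a rat2. pdx (pdy q) - pdy (pdx q))"
  have mult: "E (p * q) = E p * q + p * E q" for p q
    by (simp add: E_def pdx.mult pdy.mult pdx.add pdy.add algebra_simps)
  have poly: "E (to_fract p) = 0" for p
  proof -
    have "map_poly pderiv (pderiv p) = pderiv (map_poly pderiv p)"
      by (intro poly_eqI) (simp add: coeff_pderiv coeff_map_poly of_nat_poly pderiv_smult mult_ac del: of_nat_Suc)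
    thus ?thesis by (simp add: E_def pdx_to_fract pdy_to_fract)
  qed
  obtain a b where q: "q = Fract a b" "b \<noteq> 0" by (cases q)
  hence "q * to_fract b = to_fract a"
    by (simp add: Fract_conv_to_fract)
  with mult[of q "to_fract b"] have "E q * to_fract b = 0"
    by (simp add: poly)
  with q have "E q = 0" by simp
  thus ?thesis by (simp add: E_def)
qed


section \<open>Poisson fields\<close>

text \<open>A Poisson field over k is a field with a structure map from k and a Poisson bracket.\<close>

record ('k, 'a) poisson =
  scalar :: "'k \<Rightarrow> 'a"
  bracket :: "'a \<Rightarrow> 'a \<Rightarrow> 'a"

locale poisson_field =
  fixes K :: "('k::field, 'a::field) poisson"
  assumes scalar_1: "scalar K 1 = 1"
    and scalar_add: "scalar K (c + d) = scalar K c + scalar K d"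
    and scalar_mult: "scalar K (c * d) = scalar K c * scalar K d"
    and bracket_add: "bracket K (a + b) e = bracket K a e + bracket K b e"
    and bracket_scalar: "bracket K (scalar K c * a) b = scalar K c * bracket K a b"
    and bracket_self: "bracket K a a = 0"
    and bracket_antisym: "bracket K a b = - bracket K b a"
    and jacobi: "bracket K a (bracket K b e) + bracket K b (bracket K e a)
                   + bracket K e (bracket K a b) = 0"
    and leibniz: "bracket K (a * b) e = a * bracket K b e + bracket K a e * b"

definition rat_poisson :: "'k::field rat2 \<Rightarrow> ('k, 'k rat2) poisson" where
  "rat_poisson f = \<lparr>scalar = (\<lambda>c. to_fract (const2 c)),
                    bracket = (\<lambda>g h. (pdx g * pdy h - pdy g * pdx h) * f)\<rparr>"

lemma poisson_field_rat_poisson: "poisson_field (rat_poisson f)"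
proof
  fix c d :: 'a and a b e :: "'a rat2"
  have cx: "pdx (to_fract (const2 c)) = 0"
    by (simp add: pdx_to_fract const2_def map_poly_pCons pderiv_pCons)
  have cy: "pdy (to_fract (const2 c)) = 0"
    by (simp add: pdy_to_fract const2_def pderiv_pCons)
  note [simp] = rat_poisson_def pdx.add pdy.add pdx.mult pdy.mult pdx.diff pdy.diff
    pdx_pdy_commute
  show "scalar (rat_poisson f) 1 = 1"
    by (simp add: const2_def flip: one_pCons)
  show "scalar (rat_poisson f) (c + d) = scalar (rat_poisson f) c + scalar (rat_poisson f) d"
    by (simp add: const2_def flip: to_fract_add)
  show "scalar (rat_poisson f) (c * d) = scalar (rat_poisson f) c * scalar (rat_poisson f) d"
    by (simp add: const2_def flip: to_fract_mult)
  show "bracket (rat_poisson f) (a + b) e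
      = bracket (rat_poisson f) a e + bracket (rat_poisson f) b e"
    by (simp add: algebra_simps)
  show "bracket (rat_poisson f) (scalar (rat_poisson f) c * a) b
      = scalar (rat_poisson f) c * bracket (rat_poisson f) a b"
    by (simp add: cx cy algebra_simps)
  show "bracket (rat_poisson f) a a = 0"
    by simp
  show "bracket (rat_poisson f) a b = - bracket (rat_poisson f) b a"
    by (simp add: algebra_simps)
  show "bracket (rat_poisson f) (a * b) e
      = a * bracket (rat_poisson f) b e + bracket (rat_poisson f) a e * b"
    by (simp add: algebra_simps)
  show "bracket (rat_poisson f) a (bracket (rat_poisson f) b e)
      + bracket (rat_poisson f) b (bracket (rat_poisson f) e a)
      + bracket (rat_poisson f) e (bracket (rat_poisson f) a b) = 0"
    by (simp add: algebra_simps)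
qed

lemma bracket_X2_Y2: "bracket (rat_poisson f) (to_fract X2) (to_fract Y2) = f"
  by (simp add: rat_poisson_def X2_def Y2_def pdx_to_fract pdy_to_fract map_poly_pCons
      pderiv_pCons flip: one_pCons)

definition poisson_embedding ::
  "('k, 'a::field) poisson \<Rightarrow> ('k, 'b::field) poisson \<Rightarrow> ('a \<Rightarrow> 'b) \<Rightarrow> bool" where
  "poisson_embedding K L \<phi> \<longleftrightarrow>
     (\<forall>c. \<phi> (scalar K c) = scalar L c) \<and> \<phi> 1 = 1 \<and>
     (\<forall>a b. \<phi> (a + b) = \<phi> a + \<phi> b) \<and>
     (\<forall>a b. \<phi> (a * b) = \<phi> a * \<phi> b) \<and>
     (\<forall>a b. \<phi> (bracket K a b) = bracket L (\<phi> a) (\<phi> b)) \<and>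
     inj \<phi>"

definition poisson_embeds ::
  "('k, 'a::field) poisson \<Rightarrow> ('k, 'b::field) poisson \<Rightarrow> bool" where
  "poisson_embeds K L \<longleftrightarrow> (\<exists>\<phi>. poisson_embedding K L \<phi>)"

definition poisson_iso ::
  "('k, 'a::field) poisson \<Rightarrow> ('k, 'b::field) poisson \<Rightarrow> bool" where
  "poisson_iso K L \<longleftrightarrow> (\<exists>\<phi>. poisson_embedding K L \<phi> \<and> surj \<phi>)"


section \<open>Valuations\<close>

text \<open>The value set is the integers together with \<^const>\<open>Pinf\<close>. The type \<^typ>\<open>int extended\<close> has a
  further element \<^const>\<open>Minf\<close>, which is excluded as a value.\<close>

definition w_valuation ::
  "('k::field, 'a::field) poisson \<Rightarrow> int \<Rightarrow> ('a \<Rightarrow> int extended) \<Rightarrow> bool" where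
  "w_valuation K w \<nu> \<longleftrightarrow>
     (\<forall>a. \<nu> a \<noteq> Minf) \<and>
     (\<forall>a. \<nu> a = Pinf \<longleftrightarrow> a = 0) \<and>
     (\<forall>a b. \<nu> (a * b) = \<nu> a + \<nu> b) \<and>
     (\<forall>a b. \<nu> (a + b) \<ge> min (\<nu> a) (\<nu> b)) \<and>
     (\<forall>c. c \<noteq> 0 \<longrightarrow> \<nu> (scalar K c) = 0) \<and>
     (\<forall>a b. \<nu> (bracket K a b) \<ge> \<nu> a + \<nu> b - Fin w)"

definition trivial_valuation :: "('a::field \<Rightarrow> int extended) \<Rightarrow> bool" where
  "trivial_valuation \<nu> \<longleftrightarrow> (\<forall>a. a \<noteq> 0 \<longrightarrow> \<nu> a = 0)"

definition classical_valuation ::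
  "('k::field, 'a::field) poisson \<Rightarrow> int \<Rightarrow> ('a \<Rightarrow> int extended) \<Rightarrow> bool" where
  "classical_valuation K w \<nu> \<longleftrightarrow>
     (\<forall>a b. a \<noteq> 0 \<longrightarrow> b \<noteq> 0 \<longrightarrow> \<nu> (bracket K a b) > \<nu> a + \<nu> b - Fin w)"

definition F0 :: "('a::field \<Rightarrow> int extended) \<Rightarrow> 'a set" where
  "F0 \<nu> = {a. \<nu> a \<ge> 0}"

definition Gamma0 :: "int \<Rightarrow> ('k::field, 'a::field) poisson \<Rightarrow> 'a set" where
  "Gamma0 n K = {a. \<forall>\<nu>. w_valuation K n \<nu> \<and> \<not> trivial_valuation \<nu> \<longrightarrow> \<nu> a \<ge> 0}"

definition flabby :: "int \<Rightarrow> 'k::field poly2 \<Rightarrow> bool" where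
  "flabby d g \<longleftrightarrow> d \<ge> 1 \<and> Gamma0 d (rat_poisson (to_fract g)) = range to_fract"


section \<open>Heights\<close>

text \<open>The valuation height is meaningful only when the bracket is nontrivial. It is an infimum of
  integers in the extended reals, so it is \<^term>\<open>\<infinity> :: ereal\<close> if there is no such \<open>w\<close> and
  \<^term>\<open>- \<infinity> :: ereal\<close> if the \<open>w\<close> are unbounded below.\<close>

definition valuation_height :: "int \<Rightarrow> ('k::field, 'a::field) poisson \<Rightarrow> ereal" where
  "valuation_height n K =
     2 + Inf {ereal (of_int w) | w. \<exists>\<nu>. w_valuation K w \<nu> \<and> \<not> classical_valuation K w \<nu> \<and>
                                       F0 \<nu> \<inter> Gamma0 n K = range (scalar K)}"

text \<open>The infimum in \<^typ>\<open>enat\<close> is a minimum, or \<^term>\<open>\<infinity> :: enat\<close> for the empty set. The flag height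
  and height coheredity are meaningful for Poisson fields isomorphic to some \<^term>\<open>rat_poisson f\<close>.\<close>

definition flag_height :: "('k::field, 'a::field) poisson \<Rightarrow> enat" where
  "flag_height K = Inf {enat (total_degree g) | g. poisson_iso K (rat_poisson (to_fract g))}"

definition height_cohereditary :: "('k::field, 'a::field) poisson \<Rightarrow> bool" where
  "height_cohereditary K \<longleftrightarrow>
     (\<forall>g :: 'k rat2. poisson_embeds K (rat_poisson g) \<longrightarrow>
        flag_height K \<le> flag_height (rat_poisson g))"

end

theory Submission
  imports Defs "Berlekamp_Zassenhaus.Unique_Factorization_Poly"
begin

hide_const (open) Rat.Fract

text \<open>
  The valuation along an irreducible polynomial is a 1-valuation for every polynomial bracket, so
  \<open>\<Gamma>\<^sub>0\<close> always lies in \<open>k[x,y]\<close>. Conversely let \<open>\<nu>\<close> be a 1-valuation for the split bracket \<open>f\<close> and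
  suppose \<open>\<nu>(x) < 0\<close>. If also \<open>\<nu>(y) < 0\<close> then \<open>\<nu>(f) = m \<nu>(x) + n \<nu>(y)\<close>; otherwise at most one factor
  \<open>y + \<chi>\<^sub>k\<close> is not a unit, and since \<open>{x, y + \<chi>\<^sub>k} = f\<close> its contribution cancels. Both cases contradict
  \<open>\<nu>({x, y}) \<ge> \<nu>(x) + \<nu>(y) - 1\<close> because \<open>m, n \<ge> 3\<close>.

  For the heights, a \<open>w\<close>-valuation that is negative on both \<open>x\<close> and \<open>y\<close> has \<open>w \<ge> m + n - 2\<close> by the same
  count, with equality for minus the total degree. An embedding into \<open>K{h}\<close> with \<open>h\<close> a polynomial
  respects \<open>\<Gamma>\<^sub>0\<close> and so sends \<open>x\<close> and \<open>y\<close> to nonconstant polynomials; pulling minus the total degree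
  back along it gives \<open>deg h \<ge> m + n\<close>.
\<close>

section \<open>Integer-valued valuations\<close>

text \<open>The value \<open>v 0\<close> is left arbitrary, so every law is restricted to nonzero
  elements and values stay plain integers.\<close>

locale domain_valuation =
  fixes v :: "'a::idom \<Rightarrow> int"
  assumes val_mult: "a \<noteq> 0 \<Longrightarrow> b \<noteq> 0 \<Longrightarrow> v (a * b) = v a + v b"
    and val_add: "a \<noteq> 0 \<Longrightarrow> b \<noteq> 0 \<Longrightarrow> a + b \<noteq> 0 \<Longrightarrow> min (v a) (v b) \<le> v (a + b)"
begin

lemma val_one [simp]: "v 1 = 0"
  using val_mult[of 1 1] by simp

lemma val_minus [simp]: "v (- a) = v a"
proof (cases "a = 0")
  case False
  \<comment> \<open>The square of -1 is 1, and the integers have no 2-torsion.\<close>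
  have "v (- 1) = 0"
    using val_mult[of "- 1" "- 1"] by simp
  with False show ?thesis
    using val_mult[of "- 1" a] by simp
qed simp

text \<open>The lower bound that treats 0 as having infinite value, whatever \<open>v 0\<close>
  happens to be.\<close>

definition ge :: "int \<Rightarrow> 'a \<Rightarrow> bool" where
  "ge n a \<longleftrightarrow> a = 0 \<or> n \<le> v a"

lemma ge_0 [simp]: "ge n 0"
  by (simp add: ge_def)

lemma ge_add: "ge n a \<Longrightarrow> ge n b \<Longrightarrow> ge n (a + b)"
  using val_add[of a b] unfolding ge_def by fastforce

lemma ge_minus [simp]: "ge n (- a) \<longleftrightarrow> ge n a"
  by (simp add: ge_def)

lemma ge_diff: "ge n a \<Longrightarrow> ge n b \<Longrightarrow> ge n (a - b)"
  using ge_add[of n a "- b"] by simp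

lemma ge_mult: "ge m a \<Longrightarrow> ge n b \<Longrightarrow> ge (m + n) (a * b)"
  by (cases "a = 0"; cases "b = 0") (auto simp: ge_def val_mult)

lemma ge_mult_cancel: "b \<noteq> 0 \<Longrightarrow> ge (n + v b) (a * b) \<longleftrightarrow> ge n a"
  by (cases "a = 0") (auto simp: ge_def val_mult)

text \<open>The strictly smaller value wins: if \<open>v (a + b)\<close> exceeded
  \<open>v a\<close>, then \<open>a\<close> as the difference of \<open>a + b\<close> and
  \<open>b\<close> would have too large a value.\<close>

lemma val_add_eq:
  assumes "a \<noteq> 0" "b = 0 \<or> v a < v b"
  shows "a + b \<noteq> 0" "v (a + b) = v a"
proof -
  show nz: "a + b \<noteq> 0"
  proof
    assume "a + b = 0"
    hence "b = - a" by (simp add: eq_neg_iff_add_eq_0 add.commute)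
    with assms show False by simp
  qed
  show "v (a + b) = v a"
  proof (cases "b = 0")
    case False
    have "min (v (a + b)) (v b) \<le> v a"
      using val_add[of "a + b" "- b"] nz False assms by simp
    moreover have "min (v a) (v b) \<le> v (a + b)"
      using nz False assms by (intro val_add) simp_all
    ultimately show ?thesis using False assms by linarith
  qed simp
qed

lemma val_prod: "finite A \<Longrightarrow> (\<And>i. i \<in> A \<Longrightarrow> g i \<noteq> 0) \<Longrightarrow> v (\<Prod>i\<in>A. g i) = (\<Sum>i\<in>A. v (g i))"
proof (induction A rule: finite_induct)
  case (insert i A)
  thus ?case by (simp add: val_mult prod_zero_iff)
qed simp

end

section \<open>Extension of a valuation to the fraction field\<close>

definition fract_val :: "('a::idom \<Rightarrow> int) \<Rightarrow> 'a fract \<Rightarrow> int" where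
  "fract_val v q = (SOME n. \<exists>a b. a \<noteq> 0 \<and> b \<noteq> 0 \<and> q = Fract a b \<and> n = v a - v b)"

context domain_valuation
begin

text \<open>The choice in \<open>fract_val\<close> is harmless: cross-multiplying two
  representations shows that they give the same difference. At zero there is no admissible
  representation and the value is arbitrary.\<close>

lemma fract_val_Fract:
  assumes "a \<noteq> 0" "b \<noteq> 0"
  shows "fract_val v (Fract a b) = v a - v b"
proof -
  have "\<exists>c d. c \<noteq> 0 \<and> d \<noteq> 0 \<and> Fract a b = Fract c d \<and> fract_val v (Fract a b) = v c - v d"
    unfolding fract_val_def by (rule someI_ex) (use assms in blast)
  then obtain c d where *: "c \<noteq> 0" "d \<noteq> 0" "Fract a b = Fract c d"
      "fract_val v (Fract a b) = v c - v d" by blast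
  have "a * d = c * b"
    using * assms by (simp add: eq_fract)
  hence "v a + v d = v c + v b"
    using * assms by (metis val_mult)
  with * show ?thesis by simp
qed

lemma fract_val_to_fract [simp]: "a \<noteq> 0 \<Longrightarrow> fract_val v (to_fract a) = v a"
  by (simp add: to_fract_def fract_val_Fract)

lemma fract_cases_nonzero:
  assumes "(q :: 'a fract) \<noteq> 0"
  obtains a b where "a \<noteq> 0" "b \<noteq> 0" "q = Fract a b"
proof (cases q)
  case (Fract a b)
  thus ?thesis using assms that by (cases "a = 0") (auto simp: fract_collapse)
qed

lemma Fract_nonzero: "b \<noteq> 0 \<Longrightarrow> Fract a b \<noteq> 0 \<longleftrightarrow> a \<noteq> 0"
  by (simp add: Zero_fract_def eq_fract)

lemma domain_valuation_fract_val: "domain_valuation (fract_val v)"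
proof
  fix p q :: "'a fract"
  assume pq: "p \<noteq> 0" "q \<noteq> 0"
  obtain a b where p: "a \<noteq> 0" "b \<noteq> 0" "p = Fract a b"
    using fract_cases_nonzero[OF pq(1)] .
  obtain c d where q: "c \<noteq> 0" "d \<noteq> 0" "q = Fract c d"
    using fract_cases_nonzero[OF pq(2)] .
  show "fract_val v (p * q) = fract_val v p + fract_val v q"
    using p q by (simp add: fract_val_Fract val_mult)
  assume "p + q \<noteq> 0"
  moreover have sum: "p + q = Fract (a * d + c * b) (b * d)"
    using p q by simp
  ultimately have nz: "a * d + c * b \<noteq> 0"
    using p q by (metis Fract_nonzero mult_eq_0_iff)
  with p q have "fract_val v (p + q) = v (a * d + c * b) - (v b + v d)"
    unfolding sum by (simp add: fract_val_Fract val_mult)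
  moreover have "min (v (a * d)) (v (c * b)) \<le> v (a * d + c * b)"
    using p q nz by (intro val_add) auto
  ultimately show "min (fract_val v p) (fract_val v q) \<le> fract_val v (p + q)"
    using p q by (simp add: fract_val_Fract val_mult)
qed

end


section \<open>Valuations on Poisson fields\<close>

context poisson_field
begin

lemma scalar_0 [simp]: "scalar K 0 = 0"
  using scalar_add[of 0 0] by (metis add.right_neutral add_left_cancel)

lemma scalar_eq_0_iff [simp]: "scalar K c = 0 \<longleftrightarrow> c = 0"
proof
  assume 0: "scalar K c = 0"
  show "c = 0"
  proof (rule ccontr)
    assume "c \<noteq> 0"
    hence "scalar K c * scalar K (inverse c) = 1"
      by (simp flip: scalar_mult add: scalar_1)
    with 0 show False by simp
  qed
qed simp

lemma scalar_uminus: "scalar K (- c) = - scalar K c"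
  using scalar_add[of c "- c"] by (simp add: eq_neg_iff_add_eq_0 add.commute)

lemma scalar_diff: "scalar K (c - d) = scalar K c - scalar K d"
  using scalar_add[of c "- d"] by (simp add: scalar_uminus)

lemma bracket_0 [simp]: "bracket K 0 a = 0" "bracket K a 0 = 0"
proof -
  show *: "bracket K 0 a = 0" for a
    using bracket_add[of 0 0 a] by (metis add.right_neutral add_left_cancel)
  show "bracket K a 0 = 0"
    using bracket_antisym[of a 0] * by simp
qed

lemma bracket_add_right: "bracket K a (b + e) = bracket K a b + bracket K a e"
  using bracket_add[of b e a] bracket_antisym[of a b] bracket_antisym[of a e]
    bracket_antisym[of a "b + e"] by simp

text \<open>Leibniz applied to 1 = 1 * 1 makes the bracket with 1 equal to its own double;
  bilinearity extends its vanishing to all scalars.\<close>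

lemma bracket_scalar_right: "bracket K a (scalar K c) = 0"
proof -
  have "bracket K 1 a = 0"
    using leibniz[of 1 1 a] by (metis add.right_neutral add_left_cancel mult_1 mult.right_neutral)
  hence "bracket K (scalar K c) a = 0"
    using bracket_scalar[of c 1 a] by simp
  thus ?thesis using bracket_antisym[of a] by simp
qed

end

section \<open>Integer-valued form of w-valuations\<close>

definition with_infinity :: "('a::zero \<Rightarrow> int) \<Rightarrow> 'a \<Rightarrow> int extended" where
  "with_infinity v a = (if a = 0 then Pinf else Fin (v a))"

locale poisson_valuation = poisson_field K + domain_valuation v
  for K :: "('k::field, 'a::field) poisson" and w :: int and v :: "'a \<Rightarrow> int" +
  assumes val_scalar [simp]: "c \<noteq> 0 \<Longrightarrow> v (scalar K c) = 0"
    and val_bracket: "a \<noteq> 0 \<Longrightarrow> b \<noteq> 0 \<Longrightarrow> ge (v a + v b - w) (bracket K a b)"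

text \<open>The bridge to the official definition: only 0 has infinite value, so a valuation is
  determined by integers on the nonzero elements.\<close>

lemma w_valuation_iff:
  fixes K :: "('k::field, 'a::field) poisson"
  assumes "poisson_field K"
  shows "w_valuation K w \<nu> \<longleftrightarrow> (\<exists>v. \<nu> = with_infinity v \<and> poisson_valuation K w v)"
proof
  interpret poisson_field K by fact
  assume *: "w_valuation K w \<nu>"
  \<comment> \<open>The default 0 is taken only at infinite values, that is, at the zero
    element.\<close>
  define v where "v = (\<lambda>a. case \<nu> a of Fin n \<Rightarrow> n | _ \<Rightarrow> 0)"
  have \<nu>: "\<nu> a = Fin (v a)" if "a \<noteq> 0" for a
  proof -
    have "\<nu> a \<noteq> Minf" "\<nu> a \<noteq> Pinf"
      using * that by (simp_all add: w_valuation_def)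
    thus ?thesis by (cases "\<nu> a") (simp_all add: v_def)
  qed
  have \<nu>0: "\<nu> 0 = Pinf"
    using * by (simp add: w_valuation_def)
  have "domain_valuation v"
  proof
    fix a b :: 'a assume ab: "a \<noteq> 0" "b \<noteq> 0"
    have "\<nu> (a * b) = \<nu> a + \<nu> b" "min (\<nu> a) (\<nu> b) \<le> \<nu> (a + b)"
      using * by (simp_all add: w_valuation_def)
    thus "v (a * b) = v a + v b" "a + b \<noteq> 0 \<Longrightarrow> min (v a) (v b) \<le> v (a + b)"
      using ab by (simp_all add: \<nu>)
  qed
  then interpret domain_valuation v .
  have "poisson_valuation K w v"
  proof
    fix c :: 'k assume "c \<noteq> 0"
    moreover from this have "\<nu> (scalar K c) = 0"
      using * by (simp add: w_valuation_def)
    ultimately show "v (scalar K c) = 0"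
      by (simp add: \<nu> zero_extended_def)
  next
    fix a b :: 'a assume ab: "a \<noteq> 0" "b \<noteq> 0"
    have "\<nu> a + \<nu> b - Fin w \<le> \<nu> (bracket K a b)"
      using * by (simp add: w_valuation_def)
    thus "ge (v a + v b - w) (bracket K a b)"
      using ab by (cases "bracket K a b = 0") (auto simp: \<nu> ge_def)
  qed
  moreover have "\<nu> = with_infinity v"
    by (rule ext) (simp add: with_infinity_def \<nu> \<nu>0)
  ultimately show "\<exists>v. \<nu> = with_infinity v \<and> poisson_valuation K w v" by blast
next
  assume "\<exists>v. \<nu> = with_infinity v \<and> poisson_valuation K w v"
  then obtain v where v: "\<nu> = with_infinity v" "poisson_valuation K w v" by blast
  then interpret poisson_valuation K w v by simp
  show "w_valuation K w \<nu>"
    unfolding w_valuation_def v(1)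
  proof (intro conjI allI impI)
    fix a b :: 'a and c :: 'k
    show "with_infinity v a \<noteq> Minf" "with_infinity v a = Pinf \<longleftrightarrow> a = 0"
      by (simp_all add: with_infinity_def)
    show "with_infinity v (scalar K c) = 0" if "c \<noteq> 0"
      using that by (simp add: with_infinity_def zero_extended_def)
    show "with_infinity v (a * b) = with_infinity v a + with_infinity v b"
      by (simp add: with_infinity_def val_mult)
    show "min (with_infinity v a) (with_infinity v b) \<le> with_infinity v (a + b)"
      using val_add[of a b] by (auto simp: with_infinity_def)
    show "with_infinity v a + with_infinity v b - Fin w \<le> with_infinity v (bracket K a b)"
      using val_bracket[of a b] by (auto simp: with_infinity_def ge_def)
  qed
qed

lemma with_infinity_nonneg: "0 \<le> with_infinity v a \<longleftrightarrow> a = 0 \<or> 0 \<le> v a"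
  by (simp add: with_infinity_def zero_extended_def)

lemma trivial_with_infinity: "trivial_valuation (with_infinity v) \<longleftrightarrow> (\<forall>a. a \<noteq> 0 \<longrightarrow> v a = 0)"
  by (auto simp: trivial_valuation_def with_infinity_def zero_extended_def)

text \<open>A trivial valuation is nonnegative everywhere, so letting it into the quantifier imposes
  no further condition.\<close>

lemma Gamma0_iff:
  assumes "poisson_field K"
  shows "a \<in> Gamma0 n K \<longleftrightarrow> (\<forall>v. poisson_valuation K n v \<longrightarrow> a = 0 \<or> 0 \<le> v a)"
proof -
  have "a = 0 \<or> 0 \<le> v a" if "trivial_valuation (with_infinity v)" for v
    using that by (auto simp: trivial_with_infinity)
  moreover have "a \<in> Gamma0 n K \<longleftrightarrow> (\<forall>v. poisson_valuation K n v \<longrightarrow>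
      trivial_valuation (with_infinity v) \<or> a = 0 \<or> 0 \<le> v a)"
    unfolding Gamma0_def w_valuation_iff[OF assms] with_infinity_nonneg[symmetric] by auto
  ultimately show ?thesis by blast
qed

section \<open>Pulling valuations back along embeddings\<close>

lemma poisson_embeddingD:
  assumes "poisson_embedding K L \<phi>"
  shows "\<phi> (scalar K c) = scalar L c" "\<phi> (a + b) = \<phi> a + \<phi> b" "\<phi> (a * b) = \<phi> a * \<phi> b"
    "\<phi> (bracket K a b) = bracket L (\<phi> a) (\<phi> b)" "\<phi> a = \<phi> b \<longleftrightarrow> a = b"
  using assms by (auto simp: poisson_embedding_def inj_eq)

lemma poisson_embedding_eq_0_iff:
  assumes "poisson_embedding K L \<phi>"
  shows "\<phi> a = 0 \<longleftrightarrow> a = 0"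
proof -
  have "\<phi> 0 + \<phi> 0 = \<phi> 0 + 0"
    using poisson_embeddingD(2)[OF assms, of 0 0] by simp
  hence "\<phi> 0 = 0" by (rule add_left_imp_eq)
  with poisson_embeddingD(5)[OF assms, of a 0] show ?thesis by simp
qed

text \<open>An embedding respects sums, products, scalars and brackets, and injectivity keeps
  nonzero elements nonzero, so every axiom carries over with the same \<open>w\<close>.\<close>

lemma poisson_valuation_pullback:
  fixes K :: "('k::field, 'a::field) poisson"
  assumes K: "poisson_field K" and \<phi>: "poisson_embedding K L \<phi>" and v: "poisson_valuation L w v"
  shows "poisson_valuation K w (v \<circ> \<phi>)"
proof -
  interpret L: poisson_valuation L w v by fact
  interpret K: poisson_field K by fact
  note emb = poisson_embeddingD[OF \<phi>] and nz = poisson_embedding_eq_0_iff[OF \<phi>]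
  interpret domain_valuation "v \<circ> \<phi>"
  proof
    fix a b :: 'a assume "a \<noteq> 0" "b \<noteq> 0"
    thus "(v \<circ> \<phi>) (a * b) = (v \<circ> \<phi>) a + (v \<circ> \<phi>) b"
      by (simp add: emb L.val_mult nz)
    assume "a + b \<noteq> 0"
    with \<open>a \<noteq> 0\<close> \<open>b \<noteq> 0\<close> show "min ((v \<circ> \<phi>) a) ((v \<circ> \<phi>) b) \<le> (v \<circ> \<phi>) (a + b)"
      using L.val_add[of "\<phi> a" "\<phi> b"] nz[of "a + b"] by (simp add: emb nz)
  qed
  show ?thesis
  proof
    fix a b :: 'a assume "a \<noteq> 0" "b \<noteq> 0"
    thus "ge ((v \<circ> \<phi>) a + (v \<circ> \<phi>) b - w) (bracket K a b)"
      using L.val_bracket[of "\<phi> a" "\<phi> b"] nz[of "bracket K a b"]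
      by (simp add: emb nz ge_def L.ge_def)
  qed (simp add: emb)
qed

lemma poisson_embedding_Gamma0:
  assumes "poisson_field K" "poisson_field L" "poisson_embedding K L \<phi>" "a \<in> Gamma0 n K"
  shows "\<phi> a \<in> Gamma0 n L"
  unfolding Gamma0_iff[OF assms(2)]
proof (intro allI impI)
  fix v assume "poisson_valuation L n v"
  hence "poisson_valuation K n (v \<circ> \<phi>)"
    using poisson_valuation_pullback assms by blast
  hence "a = 0 \<or> 0 \<le> v (\<phi> a)"
    using assms(4) unfolding Gamma0_iff[OF assms(1)] by force
  thus "\<phi> a = 0 \<or> 0 \<le> v (\<phi> a)"
    using poisson_embedding_eq_0_iff[OF assms(3)] by blast
qed


section \<open>The bracket on polynomials\<close>

definition poly_bracket :: "'k::field poly2 \<Rightarrow> 'k poly2 \<Rightarrow> 'k poly2 \<Rightarrow> 'k poly2" where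
  "poly_bracket g a b = (map_poly pderiv a * pderiv b - pderiv a * map_poly pderiv b) * g"

lemma bracket_to_fract:
  "bracket (rat_poisson (to_fract g)) (to_fract a) (to_fract b) = to_fract (poly_bracket g a b)"
  by (simp add: rat_poisson_def poly_bracket_def pdx_to_fract pdy_to_fract)

text \<open>Makes the product and power rules available in the second argument; the first is reached
  by antisymmetry.\<close>

lemma derivation_poly_bracket: "derivation (poly_bracket g a)"
proof -
  interpret x: derivation "map_poly pderiv :: 'a poly2 \<Rightarrow> 'a poly2"
    by (rule derivation_map_poly[OF derivation_pderiv])
  interpret y: derivation "pderiv :: 'a poly2 \<Rightarrow> 'a poly2"
    by (rule derivation_pderiv)
  show ?thesis
    by standard (simp_all add: poly_bracket_def x.add x.mult y.add y.mult algebra_simps)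
qed

lemma poly_bracket_antisym: "poly_bracket g a b = - poly_bracket g b a"
  by (simp add: poly_bracket_def algebra_simps)

lemma poly_bracket_self [simp]: "poly_bracket g a a = 0"
  by (simp add: poly_bracket_def algebra_simps)

text \<open>Checking polynomials suffices. If \<open>B\<close> clears the denominator of
  \<open>q\<close>, Leibniz writes \<open>{q, e} B\<close> as \<open>{q B, e} - q {B, e}\<close>;
  both terms are bounded, and the factor \<open>B\<close> cancels.\<close>

lemma poisson_valuation_fract:
  fixes v :: "'k::field poly2 \<Rightarrow> int"
  assumes "domain_valuation v"
    and const: "\<And>c. c \<noteq> 0 \<Longrightarrow> v (const2 c) = 0"
    and bracket: "\<And>a b. a \<noteq> 0 \<Longrightarrow> b \<noteq> 0 \<Longrightarrow> domain_valuation.ge v (v a + v b - w) (poly_bracket g a b)"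
  shows "poisson_valuation (rat_poisson (to_fract g)) w (fract_val v)"
proof -
  interpret domain_valuation v by fact
  interpret F: domain_valuation "fract_val v" by (rule domain_valuation_fract_val)
  let ?K = "rat_poisson (to_fract g)"
  interpret K: poisson_field ?K by (rule poisson_field_rat_poisson)
  define good where "good q e \<longleftrightarrow> F.ge (fract_val v q + fract_val v e - w) (bracket ?K q e)" for q e
  have good_sym: "good q e \<Longrightarrow> good e q" for q e
    unfolding good_def by (subst K.bracket_antisym) (simp add: add.commute)
  have poly: "good (to_fract a) (to_fract b)" if "a \<noteq> 0" "b \<noteq> 0" for a b
    using bracket[OF that] that unfolding good_def bracket_to_fract
    by (cases "poly_bracket g a b = 0") (auto simp: ge_def F.ge_def)
  have extend: "good q e"
    if e: "e \<noteq> 0" "\<And>a. a \<noteq> 0 \<Longrightarrow> good (to_fract a) e" and q: "q \<noteq> 0" for q e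
  proof -
    obtain a b where ab: "a \<noteq> 0" "b \<noteq> 0" "q = Fract a b"
      using fract_cases_nonzero[OF q] .
    define B where "B = to_fract b"
    have B: "B \<noteq> 0" "to_fract a = q * B"
      using ab by (simp_all add: B_def Fract_conv_to_fract)
    have "F.ge (fract_val v (q * B) + fract_val v e - w) (bracket ?K (q * B) e)"
      using e(2)[OF ab(1)] unfolding good_def B .
    moreover have "F.ge (fract_val v q + (fract_val v B + fract_val v e - w)) (q * bracket ?K B e)"
      using e(2)[OF ab(2)] unfolding good_def B_def[symmetric]
      by (intro F.ge_mult) (simp_all add: F.ge_def)
    ultimately have "F.ge (fract_val v q + fract_val v B + fract_val v e - w)
        (bracket ?K (q * B) e - q * bracket ?K B e)"
      using q B by (intro F.ge_diff) (simp_all add: F.val_mult algebra_simps)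
    hence "F.ge (fract_val v q + fract_val v e - w + fract_val v B) (bracket ?K q e * B)"
      unfolding K.leibniz by (simp add: algebra_simps)
    thus ?thesis
      unfolding good_def using B F.ge_mult_cancel by blast
  qed
  have left: "good q (to_fract b)" if "q \<noteq> 0" "b \<noteq> 0" for q b
    using extend poly that by simp
  \<comment> \<open>Antisymmetry turns the second argument into the first, so that
    \<open>extend\<close> applies once more.\<close>
  have good: "good q e" if "q \<noteq> 0" "e \<noteq> 0" for q e
    using extend[of e q] left good_sym that by blast
  show ?thesis
  proof
    fix c :: 'k assume "c \<noteq> 0"
    thus "fract_val v (scalar ?K c) = 0"
      using const[of c] by (simp add: rat_poisson_def const2_def)
  next
    fix a b :: "'k rat2" assume "a \<noteq> 0" "b \<noteq> 0"
    thus "F.ge (fract_val v a + fract_val v b - w) (bracket ?K a b)"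
      using good unfolding good_def by blast
  qed
qed


section \<open>The total degree\<close>

lemma le_total_degree: "coeff (coeff p j) i \<noteq> 0 \<Longrightarrow> i + j \<le> total_degree p"
  unfolding total_degree_def using finite_monomials[of p] by (intro Max_ge) auto

lemma total_degree_le: "(\<And>i j. coeff (coeff p j) i \<noteq> 0 \<Longrightarrow> i + j \<le> n) \<Longrightarrow> total_degree p \<le> n"
  unfolding total_degree_def using finite_monomials[of p] by (subst Max_le_iff) auto

text \<open>The ring homomorphism \<open>x \<mapsto> t\<close>, \<open>y \<mapsto> s t\<close> into \<open>k[s][t]\<close>. It turns the total degree into the
  degree in \<open>t\<close>.\<close>

definition homogenize :: "'k::field poly2 \<Rightarrow> 'k poly2" where
  "homogenize p = poly (map_poly (map_poly (\<lambda>c. [:c:])) p) (monom [:0, 1:] 1)"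

lemma homogenize_mult: "homogenize (p * q) = homogenize p * homogenize q"
proof -
  interpret map_poly_comm_ring_hom "\<lambda>c::'a. [:c:]" ..
  interpret m: map_poly_comm_ring_hom "map_poly (\<lambda>c::'a. [:c:])" ..
  show ?thesis by (simp add: homogenize_def m.hom_mult)
qed

text \<open>The monomial \<open>x^(n-l) y^l\<close> becomes \<open>s^l t^n\<close>, with
  \<open>s\<close> the inner and \<open>t\<close> the outer variable: the coefficient of
  \<open>t^n\<close> collects the homogeneous part of degree \<open>n\<close>.\<close>

lemma coeff_homogenize:
  "coeff (coeff (homogenize p) n) l = (if l \<le> n then coeff (coeff p l) (n - l) else 0)"
proof (induction p arbitrary: n l)
  case 0
  show ?case by (simp add: homogenize_def)
next
  case (pCons q p)
  \<comment> \<open>Horner step: \<open>q + y p\<close> goes to \<open>q(t)\<close> plus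
    \<open>s t\<close> times the image of \<open>p\<close>; \<open>pCons 0\<close> is multiplication
    by \<open>t\<close>.\<close>
  have "homogenize (pCons q p) = map_poly (\<lambda>c. [:c:]) q + pCons 0 (smult [:0, 1:] (homogenize p))"
  proof -
    interpret map_poly_comm_ring_hom "\<lambda>c::'a. [:c:]" ..
    interpret m: map_poly_comm_ring_hom "map_poly (\<lambda>c::'a. [:c:])" ..
    show ?thesis
      unfolding homogenize_def hom_distribs by (simp add: monom_altdef)
  qed
  thus ?case
    by (cases n; cases l) (simp_all add: coeff_map_poly pCons.IH coeff_pCons)
qed

lemma degree_homogenize: "degree (homogenize p) = total_degree p"
proof (rule antisym)
  show "degree (homogenize p) \<le> total_degree p"
  proof (rule degree_le, intro allI impI, rule poly_eqI)
    fix n l assume "total_degree p < n"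
    hence "l \<le> n \<Longrightarrow> coeff (coeff p l) (n - l) = 0"
      using le_total_degree[of p l "n - l"] by linarith
    thus "coeff (coeff (homogenize p) n) l = coeff 0 l"
      by (simp add: coeff_homogenize)
  qed
  show "total_degree p \<le> degree (homogenize p)"
  proof (rule total_degree_le)
    fix i j assume "coeff (coeff p j) i \<noteq> 0"
    hence "coeff (coeff (homogenize p) (i + j)) j \<noteq> 0"
      by (simp add: coeff_homogenize)
    thus "i + j \<le> degree (homogenize p)"
      by (intro le_degree) auto
  qed
qed

lemma homogenize_eq_0_iff [simp]: "homogenize p = 0 \<longleftrightarrow> p = 0"
proof
  assume "homogenize p = 0"
  hence "coeff (coeff p j) i = 0" for i j
    using coeff_homogenize[of p "i + j" j] by simp
  thus "p = 0" by (intro poly_eqI) simp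
qed (simp add: homogenize_def)

text \<open>Additivity of \<open>degree\<close> over the domain \<open>k[s]\<close>, transported by
  \<open>homogenize\<close>.\<close>

lemma total_degree_mult: "p \<noteq> 0 \<Longrightarrow> q \<noteq> 0 \<Longrightarrow> total_degree (p * q) = total_degree p + total_degree q"
  by (simp add: homogenize_mult degree_mult_eq flip: degree_homogenize)

lemma total_degree_add: "total_degree (p + q) \<le> max (total_degree p) (total_degree q)"
proof (rule total_degree_le)
  fix i j assume "coeff (coeff (p + q) j) i \<noteq> 0"
  hence "coeff (coeff p j) i \<noteq> 0 \<or> coeff (coeff q j) i \<noteq> 0" by auto
  thus "i + j \<le> max (total_degree p) (total_degree q)"
    using le_total_degree[of p j i] le_total_degree[of q j i] by auto
qed

lemma total_degree_eq_0_iff: "total_degree p = 0 \<longleftrightarrow> p \<in> range const2"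
proof
  assume 0: "total_degree p = 0"
  have "p = const2 (coeff (coeff p 0) 0)"
  proof (intro poly_eqI)
    fix i j show "coeff (coeff p j) i = coeff (coeff (const2 (coeff (coeff p 0) 0)) j) i"
      using le_total_degree[of p j i] 0
      by (cases i; cases j) (auto simp: const2_def)
  qed
  thus "p \<in> range const2" by blast
next
  assume "p \<in> range const2"
  then obtain c where "p = const2 c" by blast
  hence "total_degree p \<le> 0"
    by (intro total_degree_le) (auto simp: const2_def coeff_pCons split: nat.splits)
  thus "total_degree p = 0" by simp
qed

lemma total_degree_const2 [simp]: "total_degree (const2 c) = 0"
  by (simp add: total_degree_eq_0_iff)

lemma is_unit_const2: "c \<noteq> 0 \<Longrightarrow> const2 c dvd 1"
proof
  assume "c \<noteq> 0"
  thus "1 = const2 c * const2 (inverse c)" by (simp add: const2_def flip: one_pCons)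
qed

lemma total_degree_pderiv:
  assumes "pderiv p \<noteq> 0"
  shows "total_degree (pderiv p) < total_degree p"
proof -
  have *: "i + j < total_degree p" if "coeff (coeff (pderiv p) j) i \<noteq> 0" for i j
  proof -
    have "of_nat (Suc j) * coeff p (Suc j) = smult (of_nat (Suc j)) (coeff p (Suc j))"
      by (simp add: of_nat_poly del: of_nat_Suc)
    hence "coeff (coeff p (Suc j)) i \<noteq> 0"
      using that by (auto simp: coeff_pderiv simp del: of_nat_Suc)
    thus ?thesis using le_total_degree[of p "Suc j" i] by simp
  qed
  \<comment> \<open>A surviving monomial shows that \<open>p\<close> has positive degree, so that
    \<open>total_degree p - 1\<close> below is a genuine subtraction.\<close>
  obtain i j where "coeff (coeff (pderiv p) j) i \<noteq> 0"
    using assms by (metis poly_eqI coeff_0)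
  hence "0 < total_degree p" using * by fastforce
  moreover have "total_degree (pderiv p) \<le> total_degree p - 1"
    using * by (intro total_degree_le) fastforce
  ultimately show ?thesis by linarith
qed

lemma total_degree_map_pderiv:
  assumes "map_poly pderiv p \<noteq> 0"
  shows "total_degree (map_poly pderiv p) < total_degree p"
proof -
  have *: "i + j < total_degree p" if "coeff (coeff (map_poly pderiv p) j) i \<noteq> 0" for i j
  proof -
    have "coeff (coeff p j) (Suc i) \<noteq> 0"
      using that by (auto simp: coeff_map_poly coeff_pderiv)
    thus ?thesis using le_total_degree[of p j "Suc i"] by simp
  qed
  obtain i j where "coeff (coeff (map_poly pderiv p) j) i \<noteq> 0"
    using assms by (metis poly_eqI coeff_0)
  hence "0 < total_degree p" using * by fastforce
  moreover have "total_degree (map_poly pderiv p) \<le> total_degree p - 1"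
    using * by (intro total_degree_le) fastforce
  ultimately show ?thesis by linarith
qed

section \<open>Minus the total degree: the order along the line at infinity\<close>

abbreviation neg_degree :: "'k::field poly2 \<Rightarrow> int" where
  "neg_degree p \<equiv> - int (total_degree p)"

lemma domain_valuation_neg_degree: "domain_valuation neg_degree"
proof
  fix p q :: "'a poly2"
  show "p \<noteq> 0 \<Longrightarrow> q \<noteq> 0 \<Longrightarrow> neg_degree (p * q) = neg_degree p + neg_degree q"
    by (simp add: total_degree_mult)
  show "min (neg_degree p) (neg_degree q) \<le> neg_degree (p + q)"
    using total_degree_add[of p q] by linarith
qed

text \<open>Each term of the bracket contains one derivative of each argument, which costs at least
  two degrees in all, and the factor \<open>g\<close> adds its own degree.\<close>

lemma poisson_valuation_neg_degree:
  "poisson_valuation (rat_poisson (to_fract g)) (int (total_degree g) - 2) (fract_val neg_degree)"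
proof (rule poisson_valuation_fract[OF domain_valuation_neg_degree])
  interpret domain_valuation "neg_degree :: 'a poly2 \<Rightarrow> int"
    by (rule domain_valuation_neg_degree)
  fix a b :: "'a poly2"
  have dy: "ge (neg_degree a + 1) (pderiv a)" and dx: "ge (neg_degree a + 1) (map_poly pderiv a)"
    for a :: "'a poly2"
    using total_degree_pderiv[of a] total_degree_map_pderiv[of a] unfolding ge_def by linarith+
  have "ge ((neg_degree a + 1) + (neg_degree b + 1) + neg_degree g) (poly_bracket g a b)"
    unfolding poly_bracket_def
    by (intro ge_mult ge_diff dx dy) (simp add: ge_def)
  thus "ge (neg_degree a + neg_degree b - (int (total_degree g) - 2)) (poly_bracket g a b)"
    by (simp add: algebra_simps)
qed simp


section \<open>Divisorial valuations\<close>

text \<open>The library's \<^term>\<open>multiplicity\<close> needs a sort that \<open>k[x,y]\<close> lacks over an arbitrary field.\<close>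

definition dvd_order :: "'a::idom \<Rightarrow> 'a \<Rightarrow> nat" where
  "dvd_order p a = (GREATEST n. p ^ n dvd a)"

lemma dvd_order_eq:
  assumes "p \<noteq> 0" "\<not> p dvd u"
  shows "dvd_order p (p ^ n * u) = n"
  unfolding dvd_order_def
proof (rule Greatest_equality)
  fix m assume m: "p ^ m dvd p ^ n * u"
  show "m \<le> n"
  proof (rule ccontr)
    assume "\<not> m \<le> n"
    hence "p ^ n * p dvd p ^ m"
      by (metis le_imp_power_dvd not_less_eq_eq power_Suc2)
    with m have "p ^ n * p dvd p ^ n * u" by (rule dvd_trans[rotated])
    with assms show False by simp
  qed
qed simp

lemma total_degree_pos:
  assumes "p \<noteq> 0" "\<not> p dvd 1"
  shows "0 < total_degree p"
proof (rule ccontr)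
  assume "\<not> 0 < total_degree p"
  then obtain c where c: "p = const2 c" by (auto simp: total_degree_eq_0_iff)
  hence "c \<noteq> 0" using assms by (auto simp: const2_def)
  with c assms is_unit_const2 show False by blast
qed

text \<open>Dividing out the nonunit \<open>p\<close> lowers the total degree, so the process
  stops.\<close>

lemma prime_power_decomposition:
  fixes p a :: "'k::field poly2"
  assumes p: "p \<noteq> 0" "\<not> p dvd 1" and "a \<noteq> 0"
  obtains n u where "a = p ^ n * u" "\<not> p dvd u" "u \<noteq> 0"
  using \<open>a \<noteq> 0\<close>
proof (induction "total_degree a" arbitrary: a thesis rule: less_induct)
  case less
  show ?case
  proof (cases "p dvd a")
    case True
    then obtain b where b: "a = p * b" by blast
    with less.prems have "b \<noteq> 0" by auto
    with b p have "total_degree b < total_degree a"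
      using total_degree_pos[OF p] by (simp add: total_degree_mult)
    from less.hyps[OF this _ \<open>b \<noteq> 0\<close>] obtain n u where "b = p ^ n * u" "\<not> p dvd u" "u \<noteq> 0" .
    thus ?thesis using b less.prems(1)[of "Suc n" u] by (simp add: mult.assoc)
  next
    case False
    thus ?thesis using less.prems(1)[of 0 a] less.prems(2) by simp
  qed
qed

lemma dvd_order_ge:
  fixes p a :: "'k::field poly2"
  assumes p: "p \<noteq> 0" "\<not> p dvd 1" and a: "a \<noteq> 0" "p ^ n dvd a"
  shows "n \<le> dvd_order p a"
proof -
  obtain m u where m: "a = p ^ m * u" "\<not> p dvd u" "u \<noteq> 0"
    using prime_power_decomposition[OF p a(1)] .
  show ?thesis
  proof (rule ccontr)
    assume "\<not> n \<le> dvd_order p a"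
    with m p have "m < n" by (simp add: dvd_order_eq)
    hence "p ^ m * p dvd p ^ n"
      by (metis Suc_leI le_imp_power_dvd power_Suc2)
    with a m have "p ^ m * p dvd p ^ m * u" by (metis dvd_trans)
    with m p show False by simp
  qed
qed

lemma dvd_order_dvd:
  fixes p a :: "'k::field poly2"
  assumes p: "p \<noteq> 0" "\<not> p dvd 1" and a: "a \<noteq> 0"
  shows "p ^ dvd_order p a dvd a"
proof -
  obtain m u where "a = p ^ m * u" "\<not> p dvd u" "u \<noteq> 0"
    using prime_power_decomposition[OF p a(1)] .
  thus ?thesis using p by (simp add: dvd_order_eq)
qed

text \<open>Primality gives multiplicativity, since the product of two cofactors prime to
  \<open>p\<close> is again not divisible by \<open>p\<close>; for sums, the smaller power of
  \<open>p\<close> divides both terms.\<close>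

lemma domain_valuation_dvd_order:
  fixes p :: "'k::field poly2"
  assumes "prime_elem p"
  shows "domain_valuation (\<lambda>a. int (dvd_order p a))"
proof
  have p: "p \<noteq> 0" "\<not> p dvd 1"
    using assms by (auto simp: prime_elem_def)
  fix a b :: "'k poly2"
  assume ab: "a \<noteq> 0" "b \<noteq> 0"
  obtain i u where a: "a = p ^ i * u" "\<not> p dvd u" "u \<noteq> 0"
    using prime_power_decomposition[OF p ab(1)] .
  obtain j t where b: "b = p ^ j * t" "\<not> p dvd t" "t \<noteq> 0"
    using prime_power_decomposition[OF p ab(2)] .
  have "\<not> p dvd u * t"
    using assms a b unfolding prime_elem_def by blast
  moreover have "a * b = p ^ (i + j) * (u * t)"
    by (simp add: a b power_add)
  ultimately have "dvd_order p (a * b) = i + j"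
    using p(1) by (simp only: dvd_order_eq not_False_eq_True)
  thus "int (dvd_order p (a * b)) = int (dvd_order p a) + int (dvd_order p b)"
    using a b p by (simp add: dvd_order_eq)
  assume "a + b \<noteq> 0"
  moreover have "p ^ min i j dvd a + b"
    using a b by (intro dvd_add) (simp_all add: le_imp_power_dvd dvd_mult2)
  ultimately have "min i j \<le> dvd_order p (a + b)"
    using p by (intro dvd_order_ge)
  thus "min (int (dvd_order p a)) (int (dvd_order p b)) \<le> int (dvd_order p (a + b))"
    using a b p by (simp add: dvd_order_eq)
qed

section \<open>Derivations and brackets along powers of \<open>p\<close>\<close>

lemma (in derivation) power: "d (a ^ n) = of_nat n * a ^ (n - 1) * d a"
proof (induction n)
  case (Suc n)
  thus ?case by (cases n) (simp_all add: mult algebra_simps)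
qed (simp add: one)

lemma (in derivation) power_dvd: "a ^ (n - 1) dvd d (a ^ n * u)"
proof -
  have "a ^ (n - 1) dvd d (a ^ n) * u"
    by (simp add: power)
  moreover have "a ^ (n - 1) dvd a ^ n * d u"
    by (intro dvd_mult2 le_imp_power_dvd) simp
  ultimately show ?thesis by (simp add: mult dvd_add)
qed

text \<open>A derivation lowers the order along \<open>p\<close> by at most one, and the bracket, although it
  differentiates both arguments, does the same because the bracket of \<open>p\<close> with itself vanishes.\<close>

lemma poly_bracket_power_dvd: "p ^ (i + j - 1) dvd poly_bracket g (p ^ i * u) (p ^ j * t)"
proof -
  interpret b: derivation "poly_bracket g a" for a by (rule derivation_poly_bracket)
  have "p ^ (i + j - 1) dvd p ^ i * p ^ (j - 1)"
    by (simp add: le_imp_power_dvd flip: power_add)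
  hence 1: "p ^ (i + j - 1) dvd p ^ i * poly_bracket g u (p ^ j * t)"
    using b.power_dvd by (meson dvd_trans dvd_refl mult_dvd_mono)
  have "p ^ (i + j - 1) dvd of_nat i * p ^ (i - 1) * p ^ j"
    by (cases i) (simp_all flip: power_add add: mult.assoc power_Suc[symmetric] del: power_Suc of_nat_Suc)
  hence 2: "p ^ (i + j - 1) dvd of_nat i * p ^ (i - 1) * (p ^ j * poly_bracket g p t) * u"
    by (metis dvd_mult2 mult.assoc)
  \<comment> \<open>The term with \<open>{p, p}\<close> drops out, so the full power
    \<open>p ^ j\<close> survives and only the power of \<open>p\<close> in the other argument loses
    one.\<close>
  have "poly_bracket g p (p ^ j * t) = p ^ j * poly_bracket g p t"
    by (simp add: b.mult b.power)
  hence "poly_bracket g (p ^ j * t) p = - (p ^ j * poly_bracket g p t)"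
    by (subst poly_bracket_antisym) simp
  \<comment> \<open>The arguments are swapped because the derivation rules are available in the
    second one.\<close>
  hence "poly_bracket g (p ^ j * t) (p ^ i * u) =
      - (of_nat i * p ^ (i - 1) * (p ^ j * poly_bracket g p t) * u
         + p ^ i * poly_bracket g u (p ^ j * t))"
    by (subst b.mult) (simp add: b.power poly_bracket_antisym[of g _ u] algebra_simps)
  hence "poly_bracket g (p ^ i * u) (p ^ j * t) =
      of_nat i * p ^ (i - 1) * (p ^ j * poly_bracket g p t) * u
      + p ^ i * poly_bracket g u (p ^ j * t)"
    by (subst poly_bracket_antisym) simp
  with 1 2 show ?thesis by (simp add: dvd_add)
qed

lemma poisson_valuation_dvd_order:
  fixes p :: "'k::field poly2"
  assumes "prime_elem p"
  shows "poisson_valuation (rat_poisson (to_fract g)) 1 (fract_val (\<lambda>a. int (dvd_order p a)))"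
proof (rule poisson_valuation_fract[OF domain_valuation_dvd_order[OF assms]])
  interpret domain_valuation "\<lambda>a. int (dvd_order p a)"
    by (rule domain_valuation_dvd_order[OF assms])
  have p: "p \<noteq> 0" "\<not> p dvd 1"
    using assms by (auto simp: prime_elem_def)
  fix c :: 'k assume "c \<noteq> 0"
  hence "\<not> p dvd const2 c"
    using p is_unit_const2 dvd_trans by blast
  thus "int (dvd_order p (const2 c)) = 0"
    using dvd_order_eq[OF p(1), of "const2 c" 0] by simp
next
  interpret domain_valuation "\<lambda>a. int (dvd_order p a)"
    by (rule domain_valuation_dvd_order[OF assms])
  have p: "p \<noteq> 0" "\<not> p dvd 1"
    using assms by (auto simp: prime_elem_def)
  fix a b :: "'k poly2" assume ab: "a \<noteq> 0" "b \<noteq> 0"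
  \<comment> \<open>Truncated subtraction: if both orders vanish this is 0, which still dominates
    the integer -1 required below.\<close>
  let ?n = "dvd_order p a + dvd_order p b - 1"
  have "p ^ ?n dvd poly_bracket g a b"
  proof -
    obtain u t where "a = p ^ dvd_order p a * u" "b = p ^ dvd_order p b * t"
      using dvd_order_dvd[OF p ab(1)] dvd_order_dvd[OF p ab(2)] unfolding dvd_def by blast
    thus ?thesis
      using poly_bracket_power_dvd[of p "dvd_order p a" "dvd_order p b" g u t] by simp
  qed
  hence "poly_bracket g a b = 0 \<or> ?n \<le> dvd_order p (poly_bracket g a b)"
    using dvd_order_ge[OF p] by blast
  thus "ge (int (dvd_order p a) + int (dvd_order p b) - 1) (poly_bracket g a b)"
    by (auto simp: ge_def)
qed

text \<open>In a fraction whose denominator has least total degree, a prime factor of the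
  denominator cannot divide the numerator, since cancelling it would lower that degree.\<close>

lemma prime_pole:
  fixes q :: "'k::field rat2"
  assumes "q \<notin> range to_fract"
  obtains p where "prime_elem p" "fract_val (\<lambda>a. int (dvd_order p a)) q < 0"
proof -
  define P where "P b \<longleftrightarrow> b \<noteq> 0 \<and> (\<exists>a. q = Fract a b)" for b
  obtain a\<^sub>0 b\<^sub>0 where "q = Fract a\<^sub>0 b\<^sub>0" "b\<^sub>0 \<noteq> 0"
    by (cases q)
  hence "P b\<^sub>0" by (auto simp: P_def)
  from ex_has_least_nat[of P, OF this]
  obtain b where b: "P b" and min: "\<And>b'. P b' \<Longrightarrow> total_degree b \<le> total_degree b'"
    by blast
  from b obtain a where a: "b \<noteq> 0" "q = Fract a b"
    unfolding P_def by blast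
  have "a \<noteq> 0"
    using a assms by (auto simp: fract_collapse intro: rev_image_eqI[of 0])
  have "\<not> b dvd 1"
  proof
    assume "b dvd 1"
    then obtain e where "1 = b * e" by blast
    hence "q = to_fract (a * e)"
      using a by (simp add: to_fract_def eq_fract mult_ac)
    with assms show False by blast
  qed
  then obtain F where "mset_factors F b"
    using mset_factors_exist[OF a(1)] by blast
  moreover from this obtain p where "p \<in># F"
    unfolding mset_factors_def by auto
  ultimately have p: "irreducible p" "p dvd b"
    using mset_factors_imp_dvd[of F b p] by (auto simp: mset_factors_def)
  \<comment> \<open>Irreducible elements are prime because \<open>k[x,y]\<close> is
    factorial.\<close>
  hence prime: "prime_elem p" by simp
  hence p0: "p \<noteq> 0" "\<not> p dvd 1"
    by (auto simp: prime_elem_def)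
  obtain b' where b': "b = p * b'" using p by blast
  with a have "b' \<noteq> 0" by auto
  have "\<not> p dvd a"
  proof
    assume "p dvd a"
    then obtain a' where "a = p * a'" by blast
    hence "q = Fract a' b'"
      using a b' p0 \<open>b' \<noteq> 0\<close> by (simp add: eq_fract mult_ac)
    hence "P b'" using \<open>b' \<noteq> 0\<close> by (auto simp: P_def)
    hence "total_degree b \<le> total_degree b'" by (rule min)
    thus False
      using b' p0 \<open>b' \<noteq> 0\<close> total_degree_pos[OF p0] by (simp add: total_degree_mult)
  qed
  hence "dvd_order p a = 0"
    using dvd_order_eq[of p a 0] p0 by simp
  moreover have "1 \<le> dvd_order p b"
    using p p0 a by (intro dvd_order_ge) simp_all
  ultimately have "fract_val (\<lambda>a. int (dvd_order p a)) q < 0"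
    using domain_valuation.fract_val_Fract[OF domain_valuation_dvd_order[OF prime] \<open>a \<noteq> 0\<close> a(1)] a
    by simp
  with prime show thesis by (rule that)
qed

text \<open>Since \<open>g\<close> is arbitrary, this applies also to the target of an embedding, as
  in \<open>degree_bound\<close>.\<close>

lemma Gamma0_1_subset: "Gamma0 1 (rat_poisson (to_fract g)) \<subseteq> range to_fract"
proof
  fix q assume q: "q \<in> Gamma0 1 (rat_poisson (to_fract g))"
  show "q \<in> range to_fract"
  proof (rule ccontr)
    assume nq: "q \<notin> range to_fract"
    obtain p where p: "prime_elem p" "fract_val (\<lambda>a. int (dvd_order p a)) q < 0"
      using prime_pole[OF nq] .
    have q0: "q \<noteq> 0"
    proof
      assume "q = 0"
      hence "q = to_fract 0" by simp
      with nq show False by blast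
    qed
    have "q = 0 \<or> 0 \<le> fract_val (\<lambda>a. int (dvd_order p a)) q"
      using q poisson_valuation_dvd_order[OF p(1)]
      unfolding Gamma0_iff[OF poisson_field_rat_poisson] by blast
    with q0 p(2) show False by linarith
  qed
qed


section \<open>Brackets that split into linear factors\<close>

text \<open>Stated for two elements of an abstract Poisson field, so that the roles of
  \<open>x\<close> and \<open>y\<close> can be exchanged.\<close>

definition split_bracket ::
  "('k::field, 'a::field) poisson \<Rightarrow> 'k \<Rightarrow> nat \<Rightarrow> (nat \<Rightarrow> 'k) \<Rightarrow> nat \<Rightarrow> (nat \<Rightarrow> 'k) \<Rightarrow> 'a \<Rightarrow> 'a \<Rightarrow> bool" where
  "split_bracket K c m \<xi> n \<chi> s t \<longleftrightarrow> bracket K s t =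
     scalar K c * (\<Prod>i=1..m. s + scalar K (\<xi> i)) * (\<Prod>j=1..n. t + scalar K (\<chi> j))"

lemma (in poisson_field) split_bracket_swap:
  "split_bracket K c m \<xi> n \<chi> s t \<Longrightarrow> split_bracket K (- c) n \<chi> m \<xi> t s"
  unfolding split_bracket_def
  by (subst bracket_antisym) (simp add: scalar_uminus mult_ac)

context poisson_valuation
begin

text \<open>Scalars have value 0 or are zero, so a pole dominates them.\<close>

lemma val_shift:
  assumes "s \<noteq> 0" "v s < 0"
  shows "s + scalar K d \<noteq> 0" "v (s + scalar K d) = v s"
proof -
  have "scalar K d = 0 \<or> v s < v (scalar K d)"
    using assms by (cases "d = 0") simp_all
  with assms show "s + scalar K d \<noteq> 0" "v (s + scalar K d) = v s"
    using val_add_eq by blast+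
qed

lemma val_prod_shift:
  assumes "s \<noteq> 0" "v s < 0"
  shows "(\<Prod>i=1..m. s + scalar K (\<xi> i)) \<noteq> 0" "v (\<Prod>i=1..m. s + scalar K (\<xi> i)) = int m * v s"
  using val_shift[OF assms] by (simp_all add: val_prod)

text \<open>Every linear factor has the value of \<open>s\<close> or of \<open>t\<close>, so the
  value of the bracket is known exactly and the valuation axiom bounds it.\<close>

lemma split_bracket_poles:
  assumes split: "split_bracket K c m \<xi> n \<chi> s t" "c \<noteq> 0"
    and s: "s \<noteq> 0" "v s < 0" and t: "t \<noteq> 0" "v t < 0"
  shows "v s + v t - w \<le> int m * v s + int n * v t"
proof -
  have "bracket K s t \<noteq> 0" "v (bracket K s t) = int m * v s + int n * v t"
    using split val_prod_shift[OF s, of \<xi> m] val_prod_shift[OF t, of \<chi> n]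
    unfolding split_bracket_def by (simp_all add: val_mult)
  thus ?thesis using val_bracket[OF s(1) t(1)] by (simp add: ge_def)
qed

lemma ge_scalar [simp]: "ge 0 (scalar K c)"
  by (cases "c = 0") (simp_all add: ge_def)

text \<open>Two factors of positive value would differ by the nonzero scalar
  \<open>\<chi> j - \<chi> k\<close>, which has value 0.\<close>

lemma shifts_are_units_but_one:
  fixes n :: nat
  assumes "inj_on \<chi> {1..n}" and n: "n \<ge> 1"
    and t: "ge 0 t" "t \<notin> range (scalar K)"
  obtains k where "k \<in> {1..n}" "\<And>j. j \<in> {1..n} \<Longrightarrow> j \<noteq> k \<Longrightarrow> v (t + scalar K (\<chi> j)) = 0"
proof -
  have nz: "t + scalar K d \<noteq> 0" for d
    using t(2) scalar_uminus[of d] by (metis add_eq_0_iff2 rangeI)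
  have nonneg: "0 \<le> v (t + scalar K d)" for d
    using ge_add[OF t(1) ge_scalar] nz by (simp add: ge_def)
  have unique: "j = k"
    if "j \<in> {1..n}" "0 < v (t + scalar K (\<chi> j))" "k \<in> {1..n}" "0 < v (t + scalar K (\<chi> k))" for j k
  proof (rule ccontr)
    assume "j \<noteq> k"
    hence "\<chi> j - \<chi> k \<noteq> 0"
      using that assms(1) by (auto dest: inj_onD)
    moreover have "ge 1 ((t + scalar K (\<chi> j)) - (t + scalar K (\<chi> k)))"
      using that by (intro ge_diff) (simp_all add: ge_def)
    hence "ge 1 (scalar K (\<chi> j - \<chi> k))"
      by (simp add: scalar_diff)
    ultimately show False by (simp add: ge_def)
  qed
  show thesis
  proof (cases "\<exists>k\<in>{1..n}. 0 < v (t + scalar K (\<chi> k))")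
    case True
    then obtain k where k: "k \<in> {1..n}" "0 < v (t + scalar K (\<chi> k))" by blast
    have "v (t + scalar K (\<chi> j)) = 0" if "j \<in> {1..n}" "j \<noteq> k" for j
      using unique[OF that(1) _ k] that nonneg[of "\<chi> j"] by fastforce
    with k show thesis using that by blast
  next
    case False
    have 0: "v (t + scalar K (\<chi> j)) = 0" if "j \<in> {1..n}" for j
    proof -
      have "\<not> 0 < v (t + scalar K (\<chi> j))" using False that by blast
      with nonneg[of "\<chi> j"] show ?thesis by linarith
    qed
    \<comment> \<open>All factors have value 0 here, so any index serves as the exception.\<close>
    show thesis by (rule that[of 1]) (use n 0 in simp_all)
  qed
qed

text \<open>For \<open>v s < 0\<close>, the bound \<open>m \<ge> 3\<close> gives
  \<open>m v(s) \<le> v(s) - 2\<close>, while a 1-valuation allows a loss of only 1. The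
  contribution of \<open>t\<close> cannot make up the difference in either case.\<close>

lemma split_bracket_nonneg:
  assumes split: "split_bracket K c m \<xi> n \<chi> s t" "c \<noteq> 0"
    and \<chi>: "inj_on \<chi> {1..n}" and mn: "m \<ge> 3" "n \<ge> 1" and "w = 1"
    and t: "t \<notin> range (scalar K)"
  shows "ge 0 s"
proof (rule ccontr)
  assume "\<not> ge 0 s"
  hence s: "s \<noteq> 0" "v s < 0" by (simp_all add: ge_def)
  \<comment> \<open>Multiplies \<open>2 \<le> m - 1\<close> by \<open>1 \<le> - v s\<close>; the
    latter uses that values are integers.\<close>
  have "2 * 1 \<le> int (m - 1) * (- v s)"
    using mn s by (intro mult_mono) auto
  hence ms: "int m * v s \<le> v s - 2"
    using mn by (simp add: algebra_simps of_nat_diff)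
  show False
  proof (cases "ge 0 t")
    case False
    hence t: "t \<noteq> 0" "v t < 0" by (simp_all add: ge_def)
    have "int n * v t \<le> 1 * v t"
      using mn t by (intro mult_right_mono_neg) auto
    with ms split_bracket_poles[OF split s t] \<open>w = 1\<close> show False by linarith
  next
    case True
    obtain k where k: "k \<in> {1..n}"
        "\<And>j. j \<in> {1..n} \<Longrightarrow> j \<noteq> k \<Longrightarrow> v (t + scalar K (\<chi> j)) = 0"
      using shifts_are_units_but_one[OF \<chi> mn(2) True t] by blast
    have nz: "t + scalar K d \<noteq> 0" for d
      using t scalar_uminus[of d] by (metis add_eq_0_iff2 rangeI)
    have "v (\<Prod>j=1..n. t + scalar K (\<chi> j)) = (\<Sum>j=1..n. v (t + scalar K (\<chi> j)))"
      using nz by (intro val_prod) auto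
    also have "\<dots> = v (t + scalar K (\<chi> k)) + (\<Sum>j\<in>{1..n} - {k}. v (t + scalar K (\<chi> j)))"
      using k by (intro sum.remove) auto
    also have "(\<Sum>j\<in>{1..n} - {k}. v (t + scalar K (\<chi> j))) = 0"
      using k by (intro sum.neutral) auto
    finally have prod: "v (\<Prod>j=1..n. t + scalar K (\<chi> j)) = v (t + scalar K (\<chi> k))" by simp
    have prod0: "(\<Prod>j=1..n. t + scalar K (\<chi> j)) \<noteq> 0"
      using nz by simp
    have "bracket K s t \<noteq> 0" "v (bracket K s t) = int m * v s + v (t + scalar K (\<chi> k))"
      using split val_prod_shift[OF s, of \<xi> m] prod prod0
      unfolding split_bracket_def by (simp_all add: val_mult)
    \<comment> \<open>Scalars are central, so the axiom may be applied to the shifted element, whose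
      value then occurs on both sides and cancels.\<close>
    moreover have "bracket K s (t + scalar K (\<chi> k)) = bracket K s t"
      by (simp add: bracket_add_right bracket_scalar_right)
    ultimately have "v s + v (t + scalar K (\<chi> k)) - w \<le> int m * v s + v (t + scalar K (\<chi> k))"
      using val_bracket[OF s(1) nz, of "\<chi> k"] by (simp add: ge_def)
    with ms \<open>w = 1\<close> show False by linarith
  qed
qed

end


section \<open>Split polynomials\<close>

lemma scalar_rat_poisson: "scalar (rat_poisson g) c = to_fract (const2 c)"
  by (simp add: rat_poisson_def)

lemma to_fract_prod: "to_fract (\<Prod>i\<in>A. g i) = (\<Prod>i\<in>A. to_fract (g i))"
  by (induction A rule: infinite_finite_induct) simp_all

lemma poisson_embedding_comp:
  assumes "poisson_embedding K L \<phi>" "poisson_embedding L M \<psi>"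
  shows "poisson_embedding K M (\<psi> \<circ> \<phi>)"
  using assms by (auto simp: poisson_embedding_def intro: inj_compose)

lemma poisson_iso_refl: "poisson_iso K K"
  unfolding poisson_iso_def poisson_embedding_def by (intro exI[of _ id]) simp

lemma total_degree_linear: "total_degree (X2 + const2 a) = 1" "total_degree (Y2 + const2 a) = 1"
proof -
  have "coeff (coeff (X2 + const2 a) 0) 1 \<noteq> 0" "coeff (coeff (Y2 + const2 a) 1) 0 \<noteq> 0"
    by (simp_all add: X2_def Y2_def const2_def)
  hence "1 \<le> total_degree (X2 + const2 a)" "1 \<le> total_degree (Y2 + const2 a)"
    using le_total_degree by fastforce+
  moreover have "total_degree (X2 + const2 a) \<le> 1"
  proof (rule total_degree_le)
    fix i j
    show "coeff (coeff (X2 + const2 a) j) i \<noteq> 0 \<Longrightarrow> i + j \<le> 1"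
      by (cases j; cases i; cases "i - 1") (auto simp: X2_def const2_def)
  qed
  moreover have "total_degree (Y2 + const2 a) \<le> 1"
  proof (rule total_degree_le)
    fix i j
    show "coeff (coeff (Y2 + const2 a) j) i \<noteq> 0 \<Longrightarrow> i + j \<le> 1"
      by (cases i; cases j; cases "j - 1") (auto simp: Y2_def const2_def)
  qed
  ultimately show "total_degree (X2 + const2 a) = 1" "total_degree (Y2 + const2 a) = 1"
    by simp_all
qed

lemma X2_Y2_not_const: "X2 \<notin> range const2" "Y2 \<notin> range const2"
  by (auto simp: X2_def Y2_def const2_def)

text \<open>Elements of nonnegative value form a ring containing the scalars; the Horner form is
  followed first in \<open>x\<close>, then in \<open>y\<close>.\<close>

lemma ge_polynomial:
  assumes "poisson_valuation (rat_poisson g) w v"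
    and x: "domain_valuation.ge v 0 (to_fract X2)" and y: "domain_valuation.ge v 0 (to_fract Y2)"
  shows "domain_valuation.ge v 0 (to_fract p)"
proof -
  interpret poisson_valuation "rat_poisson g" w v by fact
  have inner: "ge 0 (to_fract [:q:])" for q
  proof (induction q)
    case (pCons a q)
    have "to_fract [:pCons a q:] = scalar (rat_poisson g) a + to_fract X2 * to_fract [:q:]"
      unfolding scalar_rat_poisson by (simp add: X2_def const2_def flip: to_fract_mult to_fract_add)
    moreover have "ge 0 (to_fract X2 * to_fract [:q:])"
      using ge_mult[OF x pCons.IH] by simp
    ultimately show ?case using ge_add[OF ge_scalar] by simp
  qed simp
  show ?thesis
  proof (induction p)
    case (pCons q p)
    have "to_fract (pCons q p) = to_fract [:q:] + to_fract Y2 * to_fract p"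
      by (simp add: Y2_def flip: to_fract_mult to_fract_add)
    moreover have "ge 0 (to_fract Y2 * to_fract p)"
      using ge_mult[OF y pCons.IH] by simp
    ultimately show ?case using ge_add[OF inner] by simp
  qed simp
qed

section \<open>The split bracket: regular elements, heights and coheredity\<close>

locale split_polynomial =
  fixes c :: "'k::field" and m n :: nat and \<xi> \<chi> :: "nat \<Rightarrow> 'k" and f :: "'k poly2"
  assumes c: "c \<noteq> 0" and \<xi>: "inj_on \<xi> {1..m}" and \<chi>: "inj_on \<chi> {1..n}"
    and f: "f = const2 c * (\<Prod>i=1..m. X2 + const2 (\<xi> i)) * (\<Prod>j=1..n. Y2 + const2 (\<chi> j))"
    and m: "m \<ge> 3" and n: "n \<ge> 3"
begin

abbreviation K where "K \<equiv> rat_poisson (to_fract f)"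

lemma split: "split_bracket K c m \<xi> n \<chi> (to_fract X2) (to_fract Y2)"
  unfolding split_bracket_def bracket_X2_Y2 scalar_rat_poisson
  by (simp add: f to_fract_prod)

lemma generators_not_scalar:
  "to_fract X2 \<notin> range (scalar K)" "to_fract Y2 \<notin> range (scalar K)"
  using X2_Y2_not_const by (auto simp: scalar_rat_poisson)

lemma f_nonzero: "f \<noteq> 0"
proof -
  have "X2 + const2 a \<noteq> 0" "Y2 + const2 a \<noteq> 0" for a :: 'k
    by (simp_all add: X2_def Y2_def const2_def)
  thus ?thesis using c by (simp add: f const2_def)
qed

lemma total_degree_f: "total_degree f = m + n"
proof -
  interpret domain_valuation "neg_degree :: 'k poly2 \<Rightarrow> int"
    by (rule domain_valuation_neg_degree)
  have nz: "X2 + const2 a \<noteq> 0" "Y2 + const2 a \<noteq> 0" for a :: 'k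
    by (simp_all add: X2_def Y2_def const2_def)
  \<comment> \<open>Degrees of products are read off from \<open>val_prod\<close> for the valuation
    \<open>neg_degree\<close>.\<close>
  hence "neg_degree (\<Prod>i=1..m. X2 + const2 (\<xi> i)) = - int m"
    "neg_degree (\<Prod>j=1..n. Y2 + const2 (\<chi> j)) = - int n"
    by (subst val_prod; simp add: total_degree_linear)+
  moreover have "const2 c \<noteq> 0" using c by (simp add: const2_def)
  ultimately have "neg_degree f = - int m - int n"
    unfolding f using nz by (simp add: total_degree_mult)
  thus ?thesis by linarith
qed

lemma Gamma0_eq: "Gamma0 1 K = range to_fract"
proof
  show "range to_fract \<subseteq> Gamma0 1 K"
  proof
    fix q assume "q \<in> range (to_fract :: 'k poly2 \<Rightarrow> _)"
    then obtain p where q: "q = to_fract p" by blast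
    show "q \<in> Gamma0 1 K"
      unfolding Gamma0_iff[OF poisson_field_rat_poisson]
    proof (intro allI impI)
      fix v assume v: "poisson_valuation K 1 v"
      then interpret poisson_valuation K 1 v .
      have "ge 0 (to_fract X2)"
        using split_bracket_nonneg[OF split c \<chi>] m n generators_not_scalar by simp
      \<comment> \<open>The same argument with \<open>x\<close> and \<open>y\<close> exchanged; the
        constant becomes \<open>- c\<close>, and distinctness of the \<open>\<xi> i\<close> takes
        over.\<close>
      moreover have "ge 0 (to_fract Y2)"
        using split_bracket_nonneg[OF split_bracket_swap[OF split] _ \<xi>] c m n generators_not_scalar
        by simp
      ultimately have "ge 0 q"
        unfolding q by (rule ge_polynomial[OF v])
      thus "q = 0 \<or> 0 \<le> v q" by (simp add: ge_def)
    qed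
  qed
qed (rule Gamma0_1_subset)

text \<open>The inequality for two poles rearranges to
  \<open>w \<ge> (m - 1)(- v x) + (n - 1)(- v y)\<close>, and both pole orders are at least
  1.\<close>

lemma pole_bound:
  assumes "poisson_valuation K w v" "v (to_fract X2) < 0" "v (to_fract Y2) < 0"
  shows "int (m + n) - 2 \<le> w"
proof -
  interpret poisson_valuation K w v by fact
  have nz: "to_fract X2 \<noteq> (0 :: 'k rat2)" "to_fract Y2 \<noteq> (0 :: 'k rat2)"
    by (simp_all add: X2_def Y2_def)
  have "int (m - 1) * 1 \<le> int (m - 1) * (- v (to_fract X2))"
    "int (n - 1) * 1 \<le> int (n - 1) * (- v (to_fract Y2))"
    by (rule mult_left_mono; use assms in simp)+
  moreover have "v (to_fract X2) + v (to_fract Y2) - w \<le> int m * v (to_fract X2) + int n * v (to_fract Y2)"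
    using split_bracket_poles[OF split c nz(1) assms(2) nz(2) assms(3)] .
  ultimately show ?thesis
    using m n by (simp add: algebra_simps of_nat_diff)
qed

text \<open>The common source of the lower bound on the flag height, through isomorphisms, and of
  coheredity, through embeddings.\<close>

lemma degree_bound:
  assumes \<phi>: "poisson_embedding K (rat_poisson (to_fract h)) \<phi>"
  shows "m + n \<le> total_degree h"
proof -
  let ?v = "fract_val neg_degree \<circ> \<phi>"
  have pole: "?v q < 0" if q: "q \<in> range to_fract" "q \<notin> range (scalar K)" for q
  proof -
    have "\<phi> q \<in> Gamma0 1 (rat_poisson (to_fract h))"
      using poisson_embedding_Gamma0[OF poisson_field_rat_poisson poisson_field_rat_poisson \<phi>] q
      by (simp add: Gamma0_eq)
    then obtain p where p: "\<phi> q = to_fract p"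
      using Gamma0_1_subset by blast
    have "p \<notin> range const2"
    proof
      assume "p \<in> range const2"
      then obtain a where "p = const2 a" by blast
      \<comment> \<open>Constants of the target are already images of scalars, so injectivity would
        make \<open>q\<close> a scalar.\<close>
      hence "\<phi> q = \<phi> (scalar K a)"
        using p poisson_embeddingD(1)[OF \<phi>, of a] by (simp add: scalar_rat_poisson)
      with q show False
        using poisson_embeddingD(5)[OF \<phi>] by blast
    qed
    moreover from this have "p \<noteq> 0"
      by (auto simp: const2_def image_iff)
    ultimately show ?thesis
      using domain_valuation.fract_val_to_fract[OF domain_valuation_neg_degree, of p]
      by (simp add: p flip: total_degree_eq_0_iff)
  qed
  have "poisson_valuation K (int (total_degree h) - 2) ?v"
    using poisson_valuation_pullback[OF poisson_field_rat_poisson \<phi> poisson_valuation_neg_degree] .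
  from pole_bound[OF this pole pole] have "int (m + n) - 2 \<le> int (total_degree h) - 2"
    using generators_not_scalar by blast
  thus ?thesis by simp
qed

text \<open>The infimum is attained at \<open>w = m + n - 2\<close> by minus the total degree; the 2
  in the definition of the height restores \<open>m + n\<close>.\<close>

lemma valuation_height_eq: "valuation_height 1 K = ereal (real (m + n))"
proof -
  let ?S = "{ereal (of_int w) | w. \<exists>\<nu>. w_valuation K w \<nu> \<and> \<not> classical_valuation K w \<nu> \<and>
      F0 \<nu> \<inter> Gamma0 1 K = range (scalar K)}"
  let ?v = "fract_val neg_degree :: 'k rat2 \<Rightarrow> int"
  interpret domain_valuation "neg_degree :: 'k poly2 \<Rightarrow> int"
    by (rule domain_valuation_neg_degree)
  have v: "poisson_valuation K (int (m + n) - 2) ?v"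
    using poisson_valuation_neg_degree[of f] by (simp add: total_degree_f)
  have "\<not> classical_valuation K (int (m + n) - 2) (with_infinity ?v)"
  proof
    assume *: "classical_valuation K (int (m + n) - 2) (with_infinity ?v)"
    have nz: "X2 \<noteq> (0 :: 'k poly2)" "Y2 \<noteq> (0 :: 'k poly2)"
      by (simp_all add: X2_def Y2_def)
    have "total_degree (X2 :: 'k poly2) = 1" "total_degree (Y2 :: 'k poly2) = 1"
      using total_degree_linear[of "0 :: 'k"] by (simp_all add: const2_def)
    moreover have "with_infinity ?v (to_fract X2) + with_infinity ?v (to_fract Y2) -
        Fin (int (m + n) - 2) < with_infinity ?v (bracket K (to_fract X2) (to_fract Y2))"
      using * nz unfolding classical_valuation_def by simp
    \<comment> \<open>Equality holds at \<open>x\<close> and \<open>y\<close>: both sides are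
      \<open>- (m + n)\<close>, as \<open>{x, y} = f\<close> and both generators have degree
      1.\<close>
    ultimately show False
      using nz by (simp add: bracket_X2_Y2 with_infinity_def f_nonzero total_degree_f)
  qed
  moreover have "F0 (with_infinity ?v) \<inter> Gamma0 1 K = range (scalar K)"
  proof (intro equalityI subsetI)
    fix q assume "q \<in> F0 (with_infinity ?v) \<inter> Gamma0 1 K"
    then obtain p where p: "q = to_fract p" "q = 0 \<or> 0 \<le> ?v q"
      by (auto simp: F0_def with_infinity_nonneg Gamma0_eq)
    hence "total_degree p = 0"
      using total_degree_const2[of "0 :: 'k"] by (cases "p = 0") (auto simp: const2_def)
    thus "q \<in> range (scalar K)"
      using p by (auto simp: total_degree_eq_0_iff scalar_rat_poisson)
  next
    fix q assume "q \<in> range (scalar K)"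
    then obtain a where a: "q = to_fract (const2 a)" by (auto simp: scalar_rat_poisson)
    hence "q = 0 \<or> 0 \<le> ?v q" by (cases "const2 a = 0") simp_all
    thus "q \<in> F0 (with_infinity ?v) \<inter> Gamma0 1 K"
      using a by (auto simp: F0_def with_infinity_nonneg Gamma0_eq)
  qed
  ultimately have mem: "ereal (of_int (int (m + n) - 2)) \<in> ?S"
    using v w_valuation_iff[OF poisson_field_rat_poisson] by blast
  have "ereal (of_int (int (m + n) - 2)) \<le> e" if S: "e \<in> ?S" for e
  proof -
    obtain w \<nu> where e: "e = ereal (of_int w)" and \<nu>: "w_valuation K w \<nu>"
        and F0: "F0 \<nu> \<inter> Gamma0 1 K = range (scalar K)"
      using S by blast
    obtain v where v: "\<nu> = with_infinity v" "poisson_valuation K w v"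
      using \<nu> w_valuation_iff[OF poisson_field_rat_poisson] by blast
    \<comment> \<open>A nonscalar polynomial lies in \<open>\<Gamma>0\<close>, so the intersection
      condition keeps it out of \<open>F0\<close> and forces a pole.\<close>
    have "v q < 0" if "q \<in> range to_fract" "q \<notin> range (scalar K)" for q
    proof -
      have "q \<notin> F0 \<nu>"
        using that F0 unfolding Gamma0_eq by blast
      thus ?thesis
        unfolding F0_def v with_infinity_nonneg by simp
    qed
    hence "int (m + n) - 2 \<le> w"
      using generators_not_scalar by (intro pole_bound[OF v(2)]) blast+
    thus ?thesis unfolding e by simp
  qed
  with mem have "Inf ?S = ereal (of_int (int (m + n) - 2))"
    by (intro antisym Inf_lower Inf_greatest)
  thus ?thesis
    unfolding valuation_height_def by simp
qed

text \<open>The polynomial \<open>f\<close> itself attains the minimum, and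
  \<open>degree_bound\<close> covers every other polynomial model.\<close>

lemma flag_height_eq: "flag_height K = enat (m + n)"
  unfolding flag_height_def
proof (intro antisym Inf_lower Inf_greatest)
  show "enat (m + n) \<in> {enat (total_degree g) | g. poisson_iso K (rat_poisson (to_fract g))}"
    using poisson_iso_refl[of K] total_degree_f by (auto intro!: exI[of _ f])
  fix e assume "e \<in> {enat (total_degree g) | g. poisson_iso K (rat_poisson (to_fract g))}"
  thus "enat (m + n) \<le> e"
    using degree_bound by (auto simp: poisson_iso_def)
qed

text \<open>Composing with an isomorphism onto a polynomial model \<open>h\<close> of the larger
  field reduces to \<open>degree_bound\<close>; with no such model the infimum is infinite.\<close>

lemma height_cohereditary: "height_cohereditary K"
  unfolding height_cohereditary_def
proof (intro allI impI)
  fix g :: "'k rat2" assume "poisson_embeds K (rat_poisson g)"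
  then obtain \<phi> where \<phi>: "poisson_embedding K (rat_poisson g) \<phi>"
    by (auto simp: poisson_embeds_def)
  show "flag_height K \<le> flag_height (rat_poisson g)"
    unfolding flag_height_eq unfolding flag_height_def
  proof (rule Inf_greatest)
    fix e assume "e \<in> {enat (total_degree h) | h. poisson_iso (rat_poisson g) (rat_poisson (to_fract h))}"
    then obtain h \<psi> where h: "e = enat (total_degree h)"
        and \<psi>: "poisson_embedding (rat_poisson g) (rat_poisson (to_fract h)) \<psi>"
      by (auto simp: poisson_iso_def)
    show "enat (m + n) \<le> e"
      using degree_bound[OF poisson_embedding_comp[OF \<phi> \<psi>]] h by simp
  qed
qed

end

theorem lemma7p2:
  fixes c :: "'k::field_char_0"
    and m n :: nat
    and \<xi> \<chi> :: "nat \<Rightarrow> 'k"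
    and f :: "'k poly2"
  assumes "c \<noteq> 0"
    and "inj_on \<xi> {1..m}"
    and "inj_on \<chi> {1..n}"
    and f_def: "f = const2 c * (\<Prod>i=1..m. X2 + const2 (\<xi> i)) * (\<Prod>j=1..n. Y2 + const2 (\<chi> j))"
    and "m \<ge> 3"
    and "n \<ge> 3"
  shows "flabby 1 f \<and>
    valuation_height 1 (rat_poisson (to_fract f)) = ereal (real (total_degree f)) \<and>
    flag_height (rat_poisson (to_fract f)) = enat (total_degree f) \<and>
    height_cohereditary (rat_poisson (to_fract f))"
proof -
  interpret split_polynomial c m n \<xi> \<chi> f
    by standard (use assms in auto)
  show ?thesis
    using Gamma0_eq valuation_height_eq flag_height_eq height_cohereditary
    by (simp add: flabby_def total_degree_f)
qed

end
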